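(* Let $\xi_1,\dots,\xi_m$ be $m$ vectors in $\mathbb{R}^N$ such that $0$ belongs to their convex hull. Then for every $\varepsilon>0$, there exists $b_\varepsilon\in W^{1,\infty}(\mathbb{R}^N)$ such that $0\leq b_\varepsilon(x)\leq\varepsilon$ for every $x\in\mathbb{R}^N$ and $\nabla b_\varepsilon(x)\in\{\xi_1,\dots,\xi_m\}$ for a.e. $x\in\mathbb{R}^N$.
   Context: $N\geq1$ and $m\ge 1$ are integers. Functions in $W^{1,\infty}(\mathbb{R}^N)$ are identified with their (bounded) Lipschitz continuous representatives. *)

theory Defs
  imports "HOL-Analysis.Analysis"
begin

abbreviation partial_deriv :: "('a::euclidean_space \<Rightarrow> real) \<Rightarrow> 'a \<Rightarrow> 'a \<Rightarrow> real" where
  "partial_deriv f i \<equiv> (\<lambda>x. frechet_derivative f (at x) i)"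

primrec C_k :: "nat \<Rightarrow> ('a::euclidean_space \<Rightarrow> real) \<Rightarrow> bool" where
  "C_k 0 f \<longleftrightarrow> continuous_on UNIV f"
| "C_k (Suc k) f \<longleftrightarrow> f differentiable_on UNIV \<and> (\<forall>i\<in>Basis. C_k k (partial_deriv f i))"

definition test_function :: "('a::euclidean_space \<Rightarrow> real) \<Rightarrow> bool" where
  "test_function \<phi> \<longleftrightarrow> (\<forall>k. C_k k \<phi>) \<and> compact (closure {x. \<phi> x \<noteq> 0})"

definition locally_integrable :: "('a::euclidean_space \<Rightarrow> 'b::euclidean_space) \<Rightarrow> bool" where
  "locally_integrable f \<longleftrightarrow> (\<forall>K. compact K \<longrightarrow> set_integrable lebesgue K f)"

definition has_weak_gradient ::
    "('a::euclidean_space \<Rightarrow> real) \<Rightarrow> ('a \<Rightarrow> 'a) \<Rightarrow> bool" where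
  "has_weak_gradient f g \<longleftrightarrow> locally_integrable f \<and> locally_integrable g \<and>
     (\<forall>\<phi>. test_function \<phi> \<longrightarrow> (\<forall>i\<in>Basis.
        (LINT x|lebesgue. f x * partial_deriv \<phi> i x) = - (LINT x|lebesgue. (g x \<bullet> i) * \<phi> x)))"

(* L_infty and W_1_infty consist of functions, not of classes modulo equality a.e.;
   the choice of a representative is made explicit where it matters. *)

definition L_infty :: "('a::euclidean_space \<Rightarrow> 'b::euclidean_space) set" where
  "L_infty = {f. f \<in> borel_measurable lebesgue \<and> (\<exists>C. AE x in lebesgue. norm (f x) \<le> C)}"

definition W_1_infty :: "('a::euclidean_space \<Rightarrow> real) set" where
  "W_1_infty = {f \<in> L_infty. \<exists>g \<in> L_infty. has_weak_gradient f g}"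

end

theory Submission
  imports Defs
begin

text \<open>Let \<open>S\<close> be the set of the given vectors and write \<open>0\<close> as the barycentre of \<open>S\<close> with weights \<open>t\<close>.
  For an integer vector \<open>k\<close> with \<open>(\<Sum>v\<in>S. t v * k v) \<le> 0\<close>, averaging with the weights \<open>t\<close> shows that
  \<open>Max\<^sub>v (v \<bullet> x - \<delta> * k v)\<close> is nonnegative, while at a given point \<open>x\<close> the choice
  \<open>k v = \<lfloor>v \<bullet> x / \<delta>\<rfloor>\<close> makes it at most \<open>\<delta>\<close>.  So the infimum \<open>b\<close> over all such \<open>k\<close> is a Lipschitz function
  with values in \<open>[0, \<delta>]\<close>.  Since \<open>b x\<close> lies in one of the lattices \<open>v \<bullet> x + \<delta> \<int>\<close>, \<open>b\<close> is locally
  affine with slope in \<open>S\<close> away from the countably many hyperplanes where two of them meet.\<close>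

section \<open>Weak gradients of Lipschitz functions\<close>

lemma has_derivative_along_line:
  assumes "(f has_derivative D) (at (x + t *\<^sub>R v))"
  shows "((\<lambda>s. f (x + s *\<^sub>R v)) has_vector_derivative D v) (at t)"
proof -
  interpret bounded_linear D using assms by (rule has_derivative_bounded_linear)
  have "((\<lambda>s. x + s *\<^sub>R v) has_derivative (\<lambda>s. s *\<^sub>R v)) (at t)"
    by (auto intro!: derivative_eq_intros)
  from diff_chain_at[OF this, of f D] assms show ?thesis
    by (simp add: has_vector_derivative_def o_def scaleR)
qed

lemma has_derivative_along_line_real:
  fixes f :: "'a::real_normed_vector \<Rightarrow> real"
  assumes "(f has_derivative D) (at (x + t *\<^sub>R v))"
  shows "((\<lambda>s. f (x + s *\<^sub>R v)) has_real_derivative D v) (at t)"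
  using has_derivative_along_line[OF assms]
  by (simp add: has_real_derivative_iff_has_vector_derivative)

text \<open>Increments run through a sequence because dominated convergence is applied along
  sequences. Negative \<open>h n\<close> are allowed: moving the increment from the test function to
  \<open>f\<close> reverses its sign.\<close>

lemma difference_quotients_tendsto:
  fixes f :: "'a::real_normed_vector \<Rightarrow> real"
  assumes "(f has_derivative D) (at x)" "h \<longlonglongrightarrow> 0" "\<And>n. h n \<noteq> 0"
  shows "(\<lambda>n. (f (x + h n *\<^sub>R v) - f x) / h n) \<longlonglongrightarrow> D v"
proof -
  have "((\<lambda>s. f (x + s *\<^sub>R v)) has_real_derivative D v) (at 0)"
    using assms(1) by (intro has_derivative_along_line_real) simp
  then have "((\<lambda>s. (f (x + s *\<^sub>R v) - f x) / s) \<longlongrightarrow> D v) (at 0)"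
    by (simp add: DERIV_def)
  moreover have "filterlim h (at 0) sequentially"
    using assms(2,3) by (auto simp: filterlim_at)
  ultimately show ?thesis by (rule filterlim_compose)
qed

section \<open>Regularity and support of test functions\<close>

lemma test_function_differentiable:
  assumes "test_function \<phi>"
  shows "\<phi> differentiable (at x)"
proof -
  have "C_k (Suc 0) \<phi>" using assms unfolding test_function_def by blast
  then show ?thesis by (simp add: differentiable_on_def)
qed

lemma test_function_continuous:
  assumes "test_function \<phi>"
  shows "continuous_on UNIV \<phi>"
proof -
  have "C_k 0 \<phi>" using assms unfolding test_function_def by blast
  then show ?thesis by simp
qed

lemma test_function_partial_deriv_continuous:
  assumes "test_function \<phi>" "v \<in> Basis"
  shows "continuous_on UNIV (partial_deriv \<phi> v)"
proof -
  have "C_k (Suc 0) \<phi>" using assms unfolding test_function_def by blast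
  then show ?thesis using assms(2) by simp
qed

lemma test_function_bounded_support:
  assumes "test_function \<phi>"
  obtains R where "\<And>x. R < norm x \<Longrightarrow> \<phi> x = 0"
proof -
  have "bounded {x. \<phi> x \<noteq> 0}"
    using assms unfolding test_function_def
    by (meson bounded_subset closure_subset compact_imp_bounded)
  then obtain R where "\<And>x. \<phi> x \<noteq> 0 \<Longrightarrow> norm x \<le> R" "R > 0"
    by (auto simp: bounded_pos)
  then show thesis by (intro that[of R]) force+
qed

text \<open>The partial derivative is continuous on a closed ball containing the support and
  vanishes outside it, so it is bounded; the mean value inequality along lines does the rest. The
  constant \<open>M\<close> later dominates the difference quotients of
  \<open>\<phi>\<close>.\<close>

lemma test_function_difference_bound:
  assumes \<phi>: "test_function \<phi>" and v: "v \<in> Basis"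
  obtains M where "\<And>x t. \<bar>\<phi> (x + t *\<^sub>R v) - \<phi> x\<bar> \<le> M * \<bar>t\<bar>"
proof -
  obtain R where R: "\<And>x. R < norm x \<Longrightarrow> \<phi> x = 0"
    using test_function_bounded_support[OF \<phi>] by blast
  have deriv: "(\<phi> has_derivative frechet_derivative \<phi> (at x)) (at x)" for x
    using test_function_differentiable[OF \<phi>] by (simp add: frechet_derivative_works)
  have "bounded (partial_deriv \<phi> v ` cball 0 R)"
    using test_function_partial_deriv_continuous[OF \<phi> v]
    by (intro compact_imp_bounded compact_continuous_image) (auto intro: continuous_on_subset)
  then obtain M where M: "\<And>x. norm x \<le> R \<Longrightarrow> \<bar>partial_deriv \<phi> v x\<bar> \<le> M" "M > 0"
    unfolding bounded_pos by (metis image_eqI mem_cball_0 real_norm_def)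
  have outside: "partial_deriv \<phi> v x = 0" if "R < norm x" for x
  proof -
    have "open {x. R < norm x}" by (intro open_Collect_less continuous_intros)
    then have "(\<phi> has_derivative (\<lambda>_. 0)) (at x)"
      using has_derivative_transform_within_open[of "\<lambda>_. 0" "\<lambda>_. 0" x UNIV "{x. R < norm x}" \<phi>] that R
      by auto
    then show ?thesis by (metis frechet_derivative_at)
  qed
  have "\<bar>partial_deriv \<phi> v x\<bar> \<le> M" for x
    using M outside by (cases "norm x \<le> R") (auto simp: less_le not_le)
  then have bound: "norm (partial_deriv \<phi> v x) \<le> M" for x by simp
  have line: "((\<lambda>s. \<phi> (x + s *\<^sub>R v)) has_real_derivative partial_deriv \<phi> v (x + s *\<^sub>R v)) (at s within UNIV)" for x s
    by (rule has_derivative_along_line_real[OF deriv])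
  have "norm (\<phi> (x + t *\<^sub>R v) - \<phi> (x + 0 *\<^sub>R v)) \<le> M * norm (t - 0)" for x t
    by (rule field_differentiable_bound[OF convex_UNIV line bound UNIV_I UNIV_I])
  then show thesis by (intro that) simp
qed

section \<open>Integrability of bounded functions and integration by parts\<close>

lemma bounded_borel_imp_locally_integrable:
  fixes f :: "'a::euclidean_space \<Rightarrow> 'b::euclidean_space"
  assumes "f \<in> borel_measurable borel" "\<And>x. norm (f x) \<le> C"
  shows "locally_integrable f"
  unfolding locally_integrable_def set_integrable_def
proof (intro allI impI)
  fix K :: "'a set" assume "compact K"
  then have "K \<in> lmeasurable" by (rule lmeasurable_compact)
  then show "integrable lebesgue (\<lambda>x. indicator K x *\<^sub>R f x)"
    using assms by (intro integrableI_bounded_set_indicator[where B = C])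
      (auto simp: fmeasurable_def intro!: measurable_completion)
qed

lemma bounded_borel_imp_L_infty:
  fixes f :: "'a::euclidean_space \<Rightarrow> 'b::euclidean_space"
  assumes "f \<in> borel_measurable borel" "\<And>x. norm (f x) \<le> C"
  shows "f \<in> L_infty"
  using assms unfolding L_infty_def by (auto intro!: measurable_completion)

lemma integrable_lborel_bounded_support:
  fixes f :: "'a::euclidean_space \<Rightarrow> real"
  assumes "f \<in> borel_measurable borel" "\<And>x. \<bar>f x\<bar> \<le> B" "\<And>x. R < norm x \<Longrightarrow> f x = 0"
  shows "integrable lborel f"
  using assms
  by (intro integrableI_bounded_set[where A = "cball 0 R" and B = B])
    (auto simp: emeasure_lborel_cball_finite[unfolded infinity_ennreal_def] not_le)

lemma integral_lborel_translation:
  fixes f :: "'a::euclidean_space \<Rightarrow> real"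
  assumes [measurable]: "f \<in> borel_measurable borel"
  shows "(LINT x|lborel. f (x + c)) = (LINT x|lborel. f x)"
proof -
  have "(LINT x|lborel. f x) = (LINT x|distr lborel borel ((+) c). f x)"
    by (simp only: lborel_distr_plus)
  also have "\<dots> = (LINT x|lborel. f (c + x))"
    by (rule integral_distr) auto
  finally show ?thesis by (simp add: add.commute)
qed

text \<open>The discrete integration by parts formula for difference quotients is translation invariance
  of the integral; both sides converge by dominated convergence.\<close>

lemma lipschitz_integration_by_parts:
  fixes f :: "'a::euclidean_space \<Rightarrow> real"
  assumes lip: "L-lipschitz_on UNIV f" and bdd: "\<And>x. \<bar>f x\<bar> \<le> C"
    and [measurable]: "g \<in> borel_measurable borel"
    and grad: "AE x in lborel. GDERIV f x :> g x"
    and \<phi>: "test_function \<phi>" and v: "v \<in> Basis"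
  shows "(LINT x|lborel. f x * partial_deriv \<phi> v x) = - (LINT x|lborel. (g x \<bullet> v) * \<phi> x)"
proof -
  \<comment> \<open>All increments lie in \<open>(0, 1]\<close> and \<open>v\<close> is a unit
    vector, so the ball of radius \<open>R + 1\<close> contains the supports of all the translates
    of \<open>\<phi>\<close> that occur.\<close>
  define h :: "nat \<Rightarrow> real" where "h n = 1 / real (Suc n)" for n
  have h_pos: "h n > 0" and h_le: "h n \<le> 1" for n by (auto simp: h_def)
  have h_lim: "h \<longlonglongrightarrow> 0"
    unfolding h_def using LIMSEQ_inverse_real_of_nat by (simp add: inverse_eq_divide)
  have C: "C \<ge> 0" using bdd[of 0] by linarith
  have nv: "norm v = 1" using v by simp
  have f_cont: "continuous_on UNIV f" using lip by (rule lipschitz_on_continuous_on)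
  have \<phi>_cont: "continuous_on UNIV \<phi>" using \<phi> by (rule test_function_continuous)
  have [measurable]: "f \<in> borel_measurable borel" "\<phi> \<in> borel_measurable borel"
    "partial_deriv \<phi> v \<in> borel_measurable borel"
    using f_cont \<phi>_cont test_function_partial_deriv_continuous[OF \<phi> v]
    by (auto intro: borel_measurable_continuous_onI)
  obtain R where R: "\<And>x. R < norm x \<Longrightarrow> \<phi> x = 0"
    using test_function_bounded_support[OF \<phi>] by blast
  obtain M where M: "\<And>x t. \<bar>\<phi> (x + t *\<^sub>R v) - \<phi> x\<bar> \<le> M * \<bar>t\<bar>"
    using test_function_difference_bound[OF \<phi> v] by blast
  have M0: "M \<ge> 0" using M[of 0 1] by linarith
  have "bounded (\<phi> ` cball 0 R)"
    using \<phi>_cont by (intro compact_imp_bounded compact_continuous_image) (auto intro: continuous_on_subset)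
  then obtain B where B: "\<And>x. norm x \<le> R \<Longrightarrow> \<bar>\<phi> x\<bar> \<le> B" "B > 0"
    unfolding bounded_pos by (metis image_eqI mem_cball_0 real_norm_def)
  have \<phi>_bdd: "\<bar>\<phi> x\<bar> \<le> B" for x
    using B R by (cases "norm x \<le> R") (auto simp: less_le not_le)
  have shift_out: "\<phi> (x + h n *\<^sub>R v) = 0" "\<phi> x = 0" if "R + 1 < norm x" for x n
  proof -
    have "norm x - norm (h n *\<^sub>R v) \<le> norm (x + h n *\<^sub>R v)" by (rule norm_diff_ineq)
    then have "R < norm (x + h n *\<^sub>R v)"
      using that nv h_pos[of n] h_le[of n] by (simp add: less_imp_le)
    then show "\<phi> (x + h n *\<^sub>R v) = 0" by (rule R)
    show "\<phi> x = 0" using that by (intro R) simp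
  qed
  have prod_bdd: "\<bar>f y * \<phi> z\<bar> \<le> C * B" for y z
    unfolding abs_mult using bdd \<phi>_bdd C by (intro mult_mono) auto
  have discrete: "(LINT x|lborel. f x * ((\<phi> (x + h n *\<^sub>R v) - \<phi> x) / h n)) =
      - (LINT x|lborel. (f (x + (- h n) *\<^sub>R v) - f x) / (- h n) * \<phi> x)" for n
  proof -
    have int: "integrable lborel (\<lambda>x. f x * \<phi> (x + h n *\<^sub>R v))" "integrable lborel (\<lambda>x. f x * \<phi> x)"
      "integrable lborel (\<lambda>x. f (x - h n *\<^sub>R v) * \<phi> x)"
      using prod_bdd shift_out
      by (auto intro!: integrable_lborel_bounded_support[where B = "C * B" and R = "R + 1"])
    have "(LINT x|lborel. f x * \<phi> (x + h n *\<^sub>R v)) = (LINT x|lborel. f (x - h n *\<^sub>R v) * \<phi> x)"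
      using integral_lborel_translation[of "\<lambda>x. f (x - h n *\<^sub>R v) * \<phi> x" "h n *\<^sub>R v"] by simp
    then have "(LINT x|lborel. f x * \<phi> (x + h n *\<^sub>R v) - f x * \<phi> x) =
        (LINT x|lborel. f (x - h n *\<^sub>R v) * \<phi> x - f x * \<phi> x)"
      using int by simp
    then have "(LINT x|lborel. (f x * \<phi> (x + h n *\<^sub>R v) - f x * \<phi> x) / h n) =
        (LINT x|lborel. (f (x - h n *\<^sub>R v) * \<phi> x - f x * \<phi> x) / h n)"
      by simp
    then show ?thesis
      by (subst integral_minus[symmetric]) (simp add: algebra_simps diff_divide_distrib)
  qed
  have "(\<lambda>n. LINT x|lborel. f x * ((\<phi> (x + h n *\<^sub>R v) - \<phi> x) / h n))
      \<longlonglongrightarrow> (LINT x|lborel. f x * partial_deriv \<phi> v x)"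
  \<comment> \<open>Bound \<open>C\<close> for \<open>f\<close> and \<open>M\<close> for the
    quotients of \<open>\<phi>\<close>; outside the ball both terms of each quotient vanish.\<close>
  proof (rule integral_dominated_convergence[where w = "\<lambda>x. indicator (cball 0 (R + 1)) x *\<^sub>R (C * M)"])
    show "integrable lborel (\<lambda>x::'a. indicator (cball 0 (R + 1)) x *\<^sub>R (C * M))"
      by (rule integrableI_bounded_set_indicator[where B = "C * M"])
        (use C M0 in \<open>auto simp: emeasure_lborel_cball_finite[unfolded infinity_ennreal_def]\<close>)
    have "(\<lambda>n. (\<phi> (x + h n *\<^sub>R v) - \<phi> x) / h n) \<longlonglongrightarrow> partial_deriv \<phi> v x" for x
      using test_function_differentiable[OF \<phi>] h_lim h_pos
      by (intro difference_quotients_tendsto) (auto simp: frechet_derivative_works less_le)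
    then show "AE x in lborel. (\<lambda>n. f x * ((\<phi> (x + h n *\<^sub>R v) - \<phi> x) / h n))
        \<longlonglongrightarrow> f x * partial_deriv \<phi> v x"
      by (intro AE_I2 tendsto_intros)
    have "\<bar>(\<phi> (x + h n *\<^sub>R v) - \<phi> x) / h n\<bar> \<le> M" for x n
      using M[of x "h n"] h_pos[of n] by (simp add: divide_le_eq)
    then have "\<bar>f x * ((\<phi> (x + h n *\<^sub>R v) - \<phi> x) / h n)\<bar> \<le> C * M" for x n
      unfolding abs_mult using bdd C by (intro mult_mono) auto
    then show "AE x in lborel. norm (f x * ((\<phi> (x + h n *\<^sub>R v) - \<phi> x) / h n)) \<le>
        indicator (cball 0 (R + 1)) x *\<^sub>R (C * M)" for n
      using shift_out by (intro AE_I2) (auto simp: indicator_def not_le)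
  qed measurable
  moreover have "(\<lambda>n. LINT x|lborel. (f (x + (- h n) *\<^sub>R v) - f x) / (- h n) * \<phi> x)
      \<longlonglongrightarrow> (LINT x|lborel. (g x \<bullet> v) * \<phi> x)"
  \<comment> \<open>Now the quotient falls on \<open>f\<close>, where the Lipschitz constant bounds
    it, and \<open>\<phi>\<close> supplies the integrable factor.\<close>
  proof (rule integral_dominated_convergence[where w = "\<lambda>x. L * \<bar>\<phi> x\<bar>"])
    show "integrable lborel (\<lambda>x. L * \<bar>\<phi> x\<bar>)"
      using \<phi>_bdd R by (intro integrable_mult_right integrable_abs
          integrable_lborel_bounded_support[of _ B R]) auto
    show "AE x in lborel. (\<lambda>n. (f (x + (- h n) *\<^sub>R v) - f x) / (- h n) * \<phi> x)
        \<longlonglongrightarrow> (g x \<bullet> v) * \<phi> x"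
      using grad
    proof eventually_elim
      case (elim x)
      have "(\<lambda>n. (f (x + (- h n) *\<^sub>R v) - f x) / (- h n)) \<longlonglongrightarrow> v \<bullet> g x"
        using elim h_pos tendsto_minus[OF h_lim] unfolding gderiv_def
        by (intro difference_quotients_tendsto[where D = "\<lambda>h. h \<bullet> g x"]) (auto simp: less_le)
      then show ?case by (intro tendsto_intros) (simp add: inner_commute)
    qed
    have "\<bar>(f (x + (- h n) *\<^sub>R v) - f x) / (- h n)\<bar> \<le> L" for x n
      using lipschitz_onD[OF lip, of "x + (- h n) *\<^sub>R v" x] h_pos[of n] nv
      by (simp add: dist_norm divide_le_eq)
    then show "AE x in lborel. norm ((f (x + (- h n) *\<^sub>R v) - f x) / (- h n) * \<phi> x) \<le> L * \<bar>\<phi> x\<bar>" for n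
      by (intro AE_I2) (auto simp only: real_norm_def abs_mult intro: mult_right_mono)
  qed measurable
  ultimately show ?thesis
    unfolding discrete using LIMSEQ_unique tendsto_minus by blast
qed

lemma lipschitz_has_weak_gradient:
  fixes f :: "'a::euclidean_space \<Rightarrow> real"
  assumes lip: "L-lipschitz_on UNIV f" and bdd: "\<And>x. \<bar>f x\<bar> \<le> C"
    and g: "g \<in> borel_measurable borel" "\<And>x. norm (g x) \<le> D"
    and grad: "AE x in lborel. GDERIV f x :> g x"
  shows "has_weak_gradient f g"
  unfolding has_weak_gradient_def
proof (intro conjI allI impI ballI)
  note [measurable] = g(1)
  have [measurable]: "f \<in> borel_measurable borel"
    using lip by (intro borel_measurable_continuous_onI lipschitz_on_continuous_on)
  show "locally_integrable f" "locally_integrable g"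
    using bdd g
    by (auto intro: bounded_borel_imp_locally_integrable[where C = C]
        bounded_borel_imp_locally_integrable[where C = D])
  fix \<phi> :: "'a \<Rightarrow> real" and v :: 'a
  assume \<phi>: "test_function \<phi>" and v: "v \<in> Basis"
  have [measurable]: "\<phi> \<in> borel_measurable borel" "partial_deriv \<phi> v \<in> borel_measurable borel"
    using test_function_continuous[OF \<phi>] test_function_partial_deriv_continuous[OF \<phi> v]
    by (auto intro: borel_measurable_continuous_onI)
  show "(LINT x|lebesgue. f x * partial_deriv \<phi> v x) = - (LINT x|lebesgue. (g x \<bullet> v) * \<phi> x)"
    using lipschitz_integration_by_parts[OF lip bdd g(1) grad \<phi> v]
    \<comment> \<open>Both integrands are Borel, so their Lebesgue integrals agree with those over
      \<open>lborel\<close>.\<close>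
    by (subst (1 2) integral_completion) auto
qed

section \<open>Continuous functions with values in finitely many sloped lattices\<close>

text \<open>These are the points with \<open>f x\<close> in the lattice
  \<open>v \<bullet> x + \<delta> \<int>\<close>. Dividing by \<open>\<delta>\<close> makes the
  region a preimage of the closed set \<open>\<int>\<close>.\<close>

definition slope_region :: "real \<Rightarrow> ('a::real_inner \<Rightarrow> real) \<Rightarrow> 'a \<Rightarrow> 'a set" where
  "slope_region \<delta> f v = {x. (f x - v \<bullet> x) / \<delta> \<in> \<int>}"

text \<open>A sum of indicators is Borel and bounded at every point without any choice of a slope.
  It is the slope where exactly one region contains \<open>x\<close>; its values on overlaps are
  immaterial, as those form a null set.\<close>

definition slope_field :: "real \<Rightarrow> 'a set \<Rightarrow> ('a::real_inner \<Rightarrow> real) \<Rightarrow> 'a \<Rightarrow> 'a" where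
  "slope_field \<delta> S f x = (\<Sum>v\<in>S. indicator (slope_region \<delta> f v) x *\<^sub>R v)"

lemma closed_slope_region:
  assumes "continuous_on UNIV f"
  shows "closed (slope_region \<delta> f v)"
proof -
  have "closed ((\<lambda>x. (f x - v \<bullet> x) * inverse \<delta>) -` \<int>)"
    by (intro closed_vimage continuous_intros assms) auto
  then show ?thesis by (simp add: slope_region_def vimage_def divide_inverse)
qed

lemma slope_field_measurable:
  fixes f :: "'a::euclidean_space \<Rightarrow> real"
  assumes "continuous_on UNIV f"
  shows "slope_field \<delta> S f \<in> borel_measurable borel"
proof -
  have [measurable]: "slope_region \<delta> f v \<in> sets borel" for v
    by (intro borel_closed closed_slope_region assms)
  show ?thesis unfolding slope_field_def by measurable
qed

lemma norm_slope_field_le: "norm (slope_field \<delta> S f x) \<le> (\<Sum>v\<in>S. norm v)"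
  unfolding slope_field_def by (rule sum_norm_le) (auto simp: indicator_def)

text \<open>Subtracting the two lattice conditions eliminates \<open>f\<close> and leaves
  \<open>(v - w) \<bullet> x\<close> in \<open>\<delta> \<int>\<close>: countably many hyperplanes,
  with nonzero normal because \<open>v \<noteq> w\<close>.\<close>

lemma negligible_slope_overlap:
  fixes v w :: "'a::euclidean_space"
  assumes "\<delta> > 0" "v \<noteq> w"
  shows "negligible (slope_region \<delta> f v \<inter> slope_region \<delta> f w)"
proof (rule negligible_subset)
  show "negligible (\<Union>k::int. {x. (v - w) \<bullet> x = \<delta> * k})"
    using assms by (intro negligible_countable_Union) (auto intro!: negligible_hyperplane)
  show "slope_region \<delta> f v \<inter> slope_region \<delta> f w \<subseteq> (\<Union>k::int. {x. (v - w) \<bullet> x = \<delta> * k})"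
  proof
    fix x assume "x \<in> slope_region \<delta> f v \<inter> slope_region \<delta> f w"
    then obtain k l :: int where "(f x - v \<bullet> x) / \<delta> = k" "(f x - w \<bullet> x) / \<delta> = l"
      by (auto simp: slope_region_def Ints_def)
    then have "(v - w) \<bullet> x = \<delta> * of_int (l - k)"
      using assms by (simp add: field_simps inner_diff_left)
    then show "x \<in> (\<Union>k::int. {x. (v - w) \<bullet> x = \<delta> * k})" by blast
  qed
qed

text \<open>Away from the other closed regions, \<open>f y - v \<bullet> y\<close> is continuous with values in
  a discrete set, hence locally constant.\<close>

lemma slope_region_imp_gderiv:
  fixes f :: "'a::euclidean_space \<Rightarrow> real"
  assumes \<delta>: "\<delta> > 0" and fin: "finite S" and cont: "continuous_on UNIV f"
    and cover: "\<And>x. \<exists>v\<in>S. x \<in> slope_region \<delta> f v"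
    and x: "x \<in> slope_region \<delta> f v" and v: "v \<in> S"
    and only: "\<And>w. w \<in> S \<Longrightarrow> w \<noteq> v \<Longrightarrow> x \<notin> slope_region \<delta> f w"
  shows "GDERIV f x :> v"
proof -
  define h where "h y = (f y - v \<bullet> y) / \<delta>" for y
  have h_cont: "continuous_on UNIV h"
    unfolding h_def using \<delta> by (intro continuous_intros cont) auto
  \<comment> \<open>The window of radius 1 around \<open>h x\<close> pins down \<open>h\<close>,
    since integers at distance below 1 coincide.\<close>
  define U where "U = - (\<Union>w\<in>S - {v}. slope_region \<delta> f w) \<inter> h -` {h x - 1 <..< h x + 1}"
  have "open U"
    unfolding U_def using fin
    by (intro open_Int open_Compl closed_UN ballI closed_slope_region cont open_vimage h_cont) auto
  moreover have "x \<in> U" using only by (auto simp: U_def)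
  moreover have "f y = v \<bullet> y + \<delta> * h x" if "y \<in> U" for y
  proof -
    have "y \<in> slope_region \<delta> f v" using cover[of y] that by (auto simp: U_def)
    then have "h y \<in> \<int>" "h x \<in> \<int>" using x by (auto simp: slope_region_def h_def)
    moreover have "\<bar>h y - h x\<bar> < 1" using that by (auto simp: U_def)
    ultimately have "h y = h x" using Ints_eq_abs_less1 by blast
    moreover have "f y = v \<bullet> y + \<delta> * h y" using \<delta> by (simp add: h_def)
    ultimately show ?thesis by simp
  qed
  moreover have "((\<lambda>y. v \<bullet> y + \<delta> * h x) has_derivative (\<lambda>y. y \<bullet> v)) (at x)"
    by (auto intro!: derivative_eq_intros simp: inner_commute)
  ultimately show ?thesis
    unfolding gderiv_def using has_derivative_transform_within_open by (metis (no_types, lifting))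
qed

text \<open>Outside the null set of pairwise overlaps exactly one region contains \<open>x\<close>,
  so the sum defining the field collapses to a single slope, which is the gradient there.\<close>

lemma AE_gderiv_slope_field:
  fixes f :: "'a::euclidean_space \<Rightarrow> real"
  assumes \<delta>: "\<delta> > 0" and fin: "finite S" and cont: "continuous_on UNIV f"
    and cover: "\<And>x. \<exists>v\<in>S. x \<in> slope_region \<delta> f v"
  shows "AE x in lebesgue. GDERIV f x :> slope_field \<delta> S f x \<and> slope_field \<delta> S f x \<in> S"
proof (rule AE_I')
  define N where "N = (\<Union>v\<in>S. \<Union>w\<in>S - {v}. slope_region \<delta> f v \<inter> slope_region \<delta> f w)"
  have "negligible (\<Union>w\<in>S - {v}. slope_region \<delta> f v \<inter> slope_region \<delta> f w)" for v
    using fin by (intro negligible_Union finite_imageI finite_Diff)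
      (auto intro!: negligible_slope_overlap[OF \<delta>])
  then have "negligible N"
    unfolding N_def by (metis (no_types, lifting) fin finite_imageI imageE negligible_Union)
  then show "N \<in> null_sets lebesgue" by (simp add: negligible_iff_null_sets)
  have "GDERIV f x :> slope_field \<delta> S f x \<and> slope_field \<delta> S f x \<in> S" if "x \<notin> N" for x
  proof -
    obtain v where v: "v \<in> S" "x \<in> slope_region \<delta> f v" using cover by blast
    have only: "x \<notin> slope_region \<delta> f w" if "w \<in> S" "w \<noteq> v" for w
      using \<open>x \<notin> N\<close> v that unfolding N_def by blast
    have "slope_field \<delta> S f x = (\<Sum>w\<in>S. if w = v then v else 0)"
      unfolding slope_field_def using v only by (intro sum.cong) (auto simp: indicator_def)
    then have "slope_field \<delta> S f x = v" using fin v by simp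
    then show ?thesis
      using slope_region_imp_gderiv[OF \<delta> fin cont cover v(2,1)] only v(1) by auto
  qed
  then show "{x \<in> space lebesgue. \<not> (GDERIV f x :> slope_field \<delta> S f x \<and> slope_field \<delta> S f x \<in> S)} \<subseteq> N"
    by blast
qed

section \<open>The oscillating function\<close>

context
  fixes S :: "'a::euclidean_space set" and t :: "'a \<Rightarrow> real" and \<delta> :: real
  assumes fin: "finite S" and t_nonneg: "\<And>v. v \<in> S \<Longrightarrow> 0 \<le> t v"
    and t_sum: "sum t S = 1" and t_bary: "(\<Sum>v\<in>S. t v *\<^sub>R v) = 0" and \<delta>: "\<delta> > 0"
begin

definition shifts :: "('a \<Rightarrow> int) set" where
  "shifts = {k. (\<Sum>v\<in>S. t v * of_int (k v)) \<le> 0}"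

definition max_affine :: "('a \<Rightarrow> int) \<Rightarrow> 'a \<Rightarrow> real" where
  "max_affine k x = Max ((\<lambda>v. v \<bullet> x - \<delta> * of_int (k v)) ` S)"

definition oscillation :: "'a \<Rightarrow> real" where
  "oscillation x = (INF k\<in>shifts. max_affine k x)"

section \<open>Range of the oscillating function\<close>

lemma S_nonempty: "S \<noteq> {}"
  using t_sum by auto

lemma max_affine_ge: "v \<in> S \<Longrightarrow> v \<bullet> x - \<delta> * of_int (k v) \<le> max_affine k x"
  unfolding max_affine_def using fin by (intro Max_ge) auto

lemma max_affine_attained: "\<exists>v\<in>S. max_affine k x = v \<bullet> x - \<delta> * of_int (k v)"
proof -
  have "max_affine k x \<in> (\<lambda>v. v \<bullet> x - \<delta> * of_int (k v)) ` S"
    unfolding max_affine_def using fin S_nonempty by (intro Max_in) auto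
  then show ?thesis by blast
qed

text \<open>A maximum dominates the \<open>t\<close>-average, in which the linear terms cancel.\<close>

lemma max_affine_nonneg:
  assumes "k \<in> shifts"
  shows "0 \<le> max_affine k x"
proof -
  have "(\<Sum>v\<in>S. t v * (v \<bullet> x - \<delta> * of_int (k v))) =
      (\<Sum>v\<in>S. t v *\<^sub>R v) \<bullet> x - \<delta> * (\<Sum>v\<in>S. t v * of_int (k v))"
    by (simp add: algebra_simps sum_subtractf sum_distrib_left inner_sum_left)
  moreover have "\<delta> * (\<Sum>v\<in>S. t v * of_int (k v)) \<le> 0"
    using assms \<delta> by (simp add: shifts_def mult_le_0_iff)
  moreover have "(\<Sum>v\<in>S. t v * (v \<bullet> x - \<delta> * of_int (k v))) \<le> (\<Sum>v\<in>S. t v * max_affine k x)"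
    using t_nonneg max_affine_ge by (intro sum_mono mult_left_mono)
  moreover have "\<dots> = max_affine k x" using t_sum by (simp add: sum_distrib_right[symmetric])
  ultimately show ?thesis using t_bary by simp
qed

lemma bdd_below_max_affine: "bdd_below ((\<lambda>k. max_affine k x) ` shifts)"
  using max_affine_nonneg by (auto intro!: bdd_belowI2)

text \<open>Rounding down can only lower the \<open>t\<close>-average, and the unrounded average is
  0 because the barycentre is 0.\<close>

lemma floor_shift: "(\<lambda>v. \<lfloor>(v \<bullet> x) / \<delta>\<rfloor>) \<in> shifts"
proof -
  have "(\<Sum>v\<in>S. t v * of_int \<lfloor>(v \<bullet> x) / \<delta>\<rfloor>) \<le> (\<Sum>v\<in>S. t v * ((v \<bullet> x) / \<delta>))"
    using t_nonneg by (intro sum_mono mult_left_mono) auto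
  also have "\<dots> = (\<Sum>v\<in>S. t v *\<^sub>R v) \<bullet> x / \<delta>"
    by (simp add: inner_sum_left sum_divide_distrib)
  finally show ?thesis using t_bary by (simp add: shifts_def)
qed

lemma shifts_nonempty: "shifts \<noteq> {}"
  using floor_shift by blast

lemma oscillation_nonneg: "0 \<le> oscillation x"
  unfolding oscillation_def using shifts_nonempty max_affine_nonneg by (rule cINF_greatest)

lemma oscillation_le: "oscillation x \<le> \<delta>"
proof -
  let ?k = "\<lambda>v. \<lfloor>(v \<bullet> x) / \<delta>\<rfloor>"
  obtain v where "max_affine ?k x = v \<bullet> x - \<delta> * of_int (?k v)" using max_affine_attained[of ?k x] by blast
  \<comment> \<open>The second factor is the fractional part of
    \<open>(v \<bullet> x) / \<delta>\<close>.\<close>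
  also have "\<dots> = \<delta> * ((v \<bullet> x) / \<delta> - of_int (?k v))" using \<delta> by (simp add: field_simps)
  also have "\<dots> \<le> \<delta> * 1" using \<delta> by (intro mult_left_mono) linarith+
  finally show ?thesis
    unfolding oscillation_def using bdd_below_max_affine floor_shift by (intro cINF_lower2) auto
qed

section \<open>Lipschitz continuity and admissible values of the oscillating function\<close>

lemma max_affine_le_add:
  "max_affine k x \<le> max_affine k y + (\<Sum>v\<in>S. norm v) * dist x y"
proof -
  \<comment> \<open>Take the affine piece that is maximal at \<open>x\<close> and follow the same
    piece to \<open>y\<close>; the shift cancels, so the constant does not depend on
    \<open>k\<close>.\<close>
  obtain v where v: "v \<in> S" "max_affine k x = v \<bullet> x - \<delta> * of_int (k v)" using max_affine_attained by blast
  have "v \<bullet> (x - y) \<le> norm v * dist x y" by (simp add: dist_norm norm_cauchy_schwarz)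
  also have "\<dots> \<le> (\<Sum>v\<in>S. norm v) * dist x y"
    using v(1) fin by (intro mult_right_mono member_le_sum) auto
  finally show ?thesis using max_affine_ge[OF v(1), of y k] v(2) by (simp add: inner_diff_right)
qed

text \<open>A Lipschitz constant common to all \<open>k\<close> survives the infimum.\<close>

lemma oscillation_le_add:
  "oscillation x \<le> oscillation y + (\<Sum>v\<in>S. norm v) * dist x y"
proof -
  have "oscillation x - (\<Sum>v\<in>S. norm v) * dist x y \<le> max_affine k y" if "k \<in> shifts" for k
    using max_affine_le_add[of k x y] cINF_lower[OF bdd_below_max_affine that, of x]
    by (simp add: oscillation_def)
  then have "oscillation x - (\<Sum>v\<in>S. norm v) * dist x y \<le> oscillation y"
    using shifts_nonempty unfolding oscillation_def[of y] by (intro cINF_greatest)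
  then show ?thesis by simp
qed

lemma oscillation_lipschitz: "(\<Sum>v\<in>S. norm v)-lipschitz_on UNIV oscillation"
proof (rule lipschitz_onI)
  fix x y
  show "dist (oscillation x) (oscillation y) \<le> (\<Sum>v\<in>S. norm v) * dist x y"
    using oscillation_le_add[of x y] oscillation_le_add[of y x]
    by (simp add: dist_real_def dist_commute abs_le_iff)
qed (simp add: sum_nonneg)

text \<open>For fixed \<open>x\<close> the admissible values form a closed set, so they contain the infimum.\<close>

lemma oscillation_slope: "\<exists>v\<in>S. x \<in> slope_region \<delta> oscillation v"
proof -
  \<comment> \<open>\<open>D\<close> is the union of the lattices
    \<open>v \<bullet> x + \<delta> \<int>\<close>; it is closed because \<open>S\<close> is
    finite.\<close>
  define D where "D = (\<Union>v\<in>S. (\<lambda>r. (r - v \<bullet> x) * inverse \<delta>) -` \<int>)"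
  have "closed D"
    unfolding D_def using fin by (intro closed_UN ballI closed_vimage continuous_intros) auto
  moreover have "(\<lambda>k. max_affine k x) ` shifts \<subseteq> D"
  proof (intro image_subsetI)
    fix k
    obtain v where "v \<in> S" "max_affine k x = v \<bullet> x - \<delta> * of_int (k v)" using max_affine_attained by blast
    moreover from this have "(max_affine k x - v \<bullet> x) * inverse \<delta> = of_int (- k v)"
      using \<delta> by (simp add: field_simps)
    ultimately show "max_affine k x \<in> D" unfolding D_def by (metis Ints_of_int UN_iff vimageI2)
  qed
  moreover have "oscillation x \<in> closure ((\<lambda>k. max_affine k x) ` shifts)"
    unfolding oscillation_def using bdd_below_max_affine shifts_nonempty
    by (intro closure_contains_Inf) auto
  ultimately have "oscillation x \<in> D" using closure_minimal by blast
  then show ?thesis by (auto simp: D_def slope_region_def divide_inverse)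
qed

end

text \<open>The Lipschitz clause selects the continuous representative, so the bounds hold at every
  point. A single \<open>g\<close> serves as weak gradient and, almost everywhere, as classical
  gradient.\<close>

theorem lemma2p7:
  fixes \<xi> :: "nat \<Rightarrow> real ^ 'n" and m :: nat
  assumes "m \<ge> 1"
    and "0 \<in> convex hull (\<xi> ` {1..m})"
  shows "\<forall>\<epsilon>>0. \<exists>b :: real ^ 'n \<Rightarrow> real.
    b \<in> W_1_infty \<and> (\<exists>L. L-lipschitz_on UNIV b) \<and>
    (\<forall>x. 0 \<le> b x \<and> b x \<le> \<epsilon>) \<and>
    (\<exists>g. has_weak_gradient b g \<and>
      (AE x in lebesgue. GDERIV b x :> g x \<and> g x \<in> \<xi> ` {1..m}))"
proof (intro allI impI)
  fix \<epsilon> :: real assume \<epsilon>: "\<epsilon> > 0"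
  \<comment> \<open>Passing to the image set merges repeated vectors, so the convex weights can be
    indexed by the vectors themselves.\<close>
  define S where "S = \<xi> ` {1..m}"
  have fin: "finite S" by (simp add: S_def)
  then obtain t where t: "\<And>v. v \<in> S \<Longrightarrow> 0 \<le> t v" "sum t S = 1" "(\<Sum>v\<in>S. t v *\<^sub>R v) = 0"
    using assms(2) by (auto simp: convex_hull_finite S_def)
  note ctx = fin t \<epsilon>
  \<comment> \<open>The lattice spacing is \<open>\<epsilon>\<close> itself, since the oscillation
    stays between 0 and the spacing.\<close>
  define b where "b = oscillation S t \<epsilon>"
  define g where "g = slope_field \<epsilon> S b"
  have lip: "(\<Sum>v\<in>S. norm v)-lipschitz_on UNIV b"
    unfolding b_def by (rule oscillation_lipschitz[OF ctx])
  then have cont: "continuous_on UNIV b" by (rule lipschitz_on_continuous_on)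
  have range: "0 \<le> b x \<and> b x \<le> \<epsilon>" for x
    unfolding b_def using oscillation_nonneg[OF ctx] oscillation_le[OF ctx] by blast
  then have bdd: "\<bar>b x\<bar> \<le> \<epsilon>" for x by simp
  have "\<exists>v\<in>S. x \<in> slope_region \<epsilon> b v" for x
    unfolding b_def by (rule oscillation_slope[OF ctx])
  then have grad: "AE x in lebesgue. GDERIV b x :> g x \<and> g x \<in> S"
    unfolding g_def by (intro AE_gderiv_slope_field \<epsilon> fin cont)
  have g: "g \<in> borel_measurable borel" "\<And>x. norm (g x) \<le> (\<Sum>v\<in>S. norm v)"
    unfolding g_def by (rule slope_field_measurable[OF cont] norm_slope_field_le)+
  have "AE x in lborel. GDERIV b x :> g x"
    using grad by (simp add: AE_completion_iff)
  then have weak: "has_weak_gradient b g"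
    by (rule lipschitz_has_weak_gradient[OF lip bdd g])
  have "b \<in> L_infty" "g \<in> L_infty"
    using bdd g borel_measurable_continuous_onI[OF cont] by (auto intro: bounded_borel_imp_L_infty[where C = \<epsilon>] bounded_borel_imp_L_infty[where f = g])
  then have "b \<in> W_1_infty" using weak by (auto simp: W_1_infty_def)
  then show "\<exists>b. b \<in> W_1_infty \<and> (\<exists>L. L-lipschitz_on UNIV b) \<and> (\<forall>x. 0 \<le> b x \<and> b x \<le> \<epsilon>) \<and>
      (\<exists>g. has_weak_gradient b g \<and> (AE x in lebesgue. GDERIV b x :> g x \<and> g x \<in> \<xi> ` {1..m}))"
    using lip range weak grad unfolding S_def by blast
qed

end
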